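(* Let $K\subset L$ be fields and let $T=K+XL[X]$. Let $M$ be a subfield of $K$ and let $R=M+XL[X]$. Then: (a) Suppose that $XL[X]$ contains an element that is irreducible in $T$. Then $R$ is an idf-domain if and only if $T$ is an idf-domain and the multiplicative group $K^{\ast}/M^{\ast}$ is finite. (b) Suppose that $XL[X]$ contains no element that is irreducible in $T$. Then $R$ is an idf-domain if and only if $T$ is an idf-domain.
   Context: All rings are commutative with unity. For $A\subset B$ rings, $A+XB[X]$ denotes the subring of the polynomial ring $B[X]$ consisting of the polynomials whose constant term lies in $A$. For an integral domain $R$, $R^{\ast}$ denotes its group of invertible elements. An integral domain is an idf-domain (irreducible-divisor-finite) if each nonzero element has at most a finite number of nonassociate irreducible divisors. *)

theory Defs
  imports "HOL-Algebra.UnivPoly" "HOL-Algebra.Ring_Divisibility" "HOL-Algebra.Subrings"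
begin

text \<open>The subring \<open>A + X B[X]\<close> of \<open>B[X]\<close>.\<close>

definition const_term_ring ::
  "('a, 'm) ring_scheme \<Rightarrow> 'a set \<Rightarrow> ('a, nat \<Rightarrow> 'a) up_ring"
  where "const_term_ring B A =
    (UP B) \<lparr> carrier := {p \<in> carrier (UP B). coeff (UP B) p 0 \<in> A} \<rparr>"

text \<open>The ideal \<open>X B[X]\<close> of \<open>B[X]\<close>.\<close>

definition X_ideal :: "('a, 'm) ring_scheme \<Rightarrow> (nat \<Rightarrow> 'a) set"
  where "X_ideal B = PIdl\<^bsub>UP B\<^esub> (monom (UP B) \<one>\<^bsub>B\<^esub> 1)"

text \<open>Nonassociate divisors are counted as classes of irreducible divisors under
  the associate relation.  Divisibility, associates and irreducibility are all
  taken inside \<open>R\<close>; \<open>ring_irreducible\<close> excludes zero and units.\<close>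

definition irreducible_divisors :: "('a, 'm) ring_scheme \<Rightarrow> 'a \<Rightarrow> 'a set"
  where "irreducible_divisors R a =
    {d \<in> carrier R. ring_irreducible\<^bsub>R\<^esub> d \<and> d divides\<^bsub>R\<^esub> a}"

definition idf_domain :: "('a, 'm) ring_scheme \<Rightarrow> bool"
  where "idf_domain R \<longleftrightarrow> domain R \<and>
    (\<forall>a \<in> carrier R - {\<zero>\<^bsub>R\<^esub>}.
      finite (irreducible_divisors R a //
        {(x, y). x \<in> carrier R \<and> y \<in> carrier R \<and> x \<sim>\<^bsub>R\<^esub> y}))"

end

theory Submission
  imports Defs
begin

text \<open>The variable \<open>X\<close> is irreducible in \<open>K + XL[X]\<close>, so part (b) is vacuous. For every subfield \<open>F\<close> of
  \<open>L\<close>, the ring \<open>F + XL[X]\<close> is an idf-domain iff \<open>L\<^sup>*/F\<^sup>*\<close> is finite: on the one hand, all \<open>aX\<close> with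
  \<open>a \<in> L\<^sup>*\<close> are irreducible divisors of \<open>X\<^sup>2\<close>, associate only if their coefficients agree modulo \<open>F\<^sup>*\<close>;
  on the other hand, a nonzero polynomial has finitely many divisors up to \<open>L\<^sup>*\<close> in the factorial domain
  \<open>L[X]\<close>, and \<open>L\<^sup>*\<close>-associates are \<open>F\<^sup>*\<close>-associates once their leading coefficients agree modulo
  \<open>F\<^sup>*\<close>. Finally \<open>L\<^sup>*/M\<^sup>*\<close> is finite iff \<open>L\<^sup>*/K\<^sup>*\<close> and \<open>K\<^sup>*/M\<^sup>*\<close> are.\<close>

section \<open>Finiteness of images and of coset spaces\<close>

text \<open>On \<open>A\<close> the map \<open>g\<close> factors through \<open>f\<close>, so its
  image is itself an image of that of \<open>f\<close>. This transfers finiteness from a set of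
  invariants to the classes that they determine.\<close>

lemma finite_image_factor:
  assumes "finite (f ` A)" and "\<And>x y. \<lbrakk>x \<in> A; y \<in> A; f x = f y\<rbrakk> \<Longrightarrow> g x = g y"
  shows "finite (g ` A)"
proof -
  have "g ` A \<subseteq> (\<lambda>z. g (inv_into A f z)) ` f ` A"
  proof
    fix w assume "w \<in> g ` A"
    then obtain x where x: "x \<in> A" "w = g x" by blast
    then have "g x = g (inv_into A f (f x))"
      by (intro assms(2)) (auto simp: inv_into_into f_inv_into_f)
    then show "w \<in> (\<lambda>z. g (inv_into A f z)) ` f ` A" using x by blast
  qed
  then show ?thesis using assms(1) finite_subset by blast
qed

lemma (in group) rcos_eq_iff:
  assumes "subgroup H G" "x \<in> carrier G" "y \<in> carrier G"
  shows "H #> x = H #> y \<longleftrightarrow> (\<exists>h \<in> H. x = h \<otimes> y)"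
proof
  assume "H #> x = H #> y"
  then have "x \<in> H #> y" using assms rcos_self by blast
  then show "\<exists>h \<in> H. x = h \<otimes> y" by (auto simp: r_coset_def)
next
  assume "\<exists>h \<in> H. x = h \<otimes> y"
  then have "x \<in> H #> y" by (auto simp: r_coset_def)
  then show "H #> x = H #> y" using assms repr_independence by metis
qed

text \<open>A qualitative form of the multiplicativity of indices: if \<open>S\<close> represents
  the cosets of \<open>N\<close> in \<open>G\<close> and \<open>U\<close> those of \<open>H\<close>
  in \<open>N\<close>, then the products of elements of \<open>U\<close> with elements of
  \<open>S\<close> represent the cosets of \<open>H\<close> in \<open>G\<close>.\<close>

lemma (in group) finite_rcosets_tower:
  assumes H: "subgroup H G" and N: "subgroup N G" and "H \<subseteq> N"
  shows "finite (rcosets H) \<longleftrightarrow> finite (rcosets N) \<and> finite (rcosets\<^bsub>G\<lparr>carrier := N\<rparr>\<^esub> H)"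
proof -
  have im: "rcosets S = (\<lambda>a. S #> a) ` carrier G" for S
    by (auto simp: RCOSETS_def)
  have imN: "rcosets\<^bsub>G\<lparr>carrier := N\<rparr>\<^esub> H = (\<lambda>a. H #> a) ` N"
    by (auto simp: RCOSETS_def r_coset_def)
  have NG: "N \<subseteq> carrier G" and HG: "H \<subseteq> carrier G"
    using H N by (auto dest: subgroup.subset)
  show ?thesis unfolding im imN
  proof (intro iffI conjI)
    assume fin: "finite ((\<lambda>a. H #> a) ` carrier G)"
    show "finite ((\<lambda>a. H #> a) ` N)"
      using fin NG by (meson finite_subset image_mono)
    show "finite ((\<lambda>a. N #> a) ` carrier G)"
      by (rule finite_image_factor[OF fin])
        (use H N \<open>H \<subseteq> N\<close> in \<open>auto simp: rcos_eq_iff\<close>)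
  next
    assume "finite ((\<lambda>a. N #> a) ` carrier G) \<and> finite ((\<lambda>a. H #> a) ` N)"
    then have fin: "finite ((\<lambda>a. N #> a) ` carrier G)" "finite ((\<lambda>a. H #> a) ` N)" by auto
    obtain S where S: "finite S" "S \<subseteq> carrier G" "(\<lambda>a. N #> a) ` carrier G = (\<lambda>a. N #> a) ` S"
      using finite_subset_image[OF fin(1) order_refl] by metis
    obtain U where U: "finite U" "U \<subseteq> N" "(\<lambda>a. H #> a) ` N = (\<lambda>a. H #> a) ` U"
      using finite_subset_image[OF fin(2) order_refl] by metis
    have "(\<lambda>a. H #> a) ` carrier G \<subseteq> (\<lambda>(u, s). H #> (u \<otimes> s)) ` (U \<times> S)"
    proof clarify
      fix a assume a: "a \<in> carrier G"
      then obtain s where s: "s \<in> S" "N #> a = N #> s" using S(3) by (metis imageE imageI)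
      then obtain n where n: "n \<in> N" "a = n \<otimes> s"
        using a N S(2) rcos_eq_iff[OF N, of a s] by blast
      then obtain u where u: "u \<in> U" "H #> n = H #> u" using U(3) by (metis imageE imageI)
      have "H #> a = (H #> n) #> s" using n s S(2) HG NG coset_mult_assoc by (metis subsetD)
      also have "\<dots> = H #> (u \<otimes> s)" using u s S(2) U(2) HG NG coset_mult_assoc by (metis subsetD)
      finally show "H #> a \<in> (\<lambda>(u, s). H #> (u \<otimes> s)) ` (U \<times> S)" using u s by force
    qed
    then show "finite ((\<lambda>a. H #> a) ` carrier G)"
      using S(1) U(1) by (meson finite_SigmaI finite_imageI finite_subset)
  qed
qed

section \<open>Divisors up to associates in factorial monoids and domains\<close>

lemma finite_submultisets: "finite {N. N \<subseteq># M}"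
proof (induction M)
  case (add x M)
  have "{N. N \<subseteq># add_mset x M} \<subseteq> {N. N \<subseteq># M} \<union> add_mset x ` {N. N \<subseteq># M}"
  proof
    fix N assume "N \<in> {N. N \<subseteq># add_mset x M}"
    then have N: "N \<subseteq># add_mset x M" by simp
    show "N \<in> {N. N \<subseteq># M} \<union> add_mset x ` {N. N \<subseteq># M}"
    proof (cases "x \<in># N")
      case True
      then obtain N' where "N = add_mset x N'" by (metis multi_member_split)
      then show ?thesis using N by auto
    next
      case False
      then show ?thesis using N
        by (metis CollectI UnI1 add_mset_remove_trivial diff_single_trivial subset_eq_diff_conv
            add_mset_add_single)
    qed
  qed
  then show ?case using add by (meson finite_UnI finite_imageI finite_subset)
qed simp

text \<open>Up to associates a divisor of \<open>a\<close> is determined by the multiset of classes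
  of its irreducible factors, and that multiset is one of the finitely many submultisets of the one
  for \<open>a\<close>.\<close>

lemma (in factorial_monoid) finite_divisor_classes:
  assumes a: "a \<in> carrier G"
  shows "finite ((\<lambda>d. {x \<in> carrier G. x \<sim> d}) ` {d \<in> carrier G. d divides a})"
proof -
  \<comment> \<open>Fixing one factorization for each \<open>d\<close> turns the multiset of
    irreducible classes into a function of \<open>d\<close>.\<close>
  define w where "w d = (SOME fs. set fs \<subseteq> carrier G \<and> wfactors G fs d)" for d
  have w: "set (w d) \<subseteq> carrier G \<and> wfactors G (w d) d" if "d \<in> carrier G" for d
    unfolding w_def by (rule someI_ex) (use that in blast)
  have "(\<lambda>d. fmset G (w d)) ` {d \<in> carrier G. d divides a} \<subseteq> {N. N \<subseteq># fmset G (w a)}"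
    using w a divides_fmsubset by blast
  then have "finite ((\<lambda>d. fmset G (w d)) ` {d \<in> carrier G. d divides a})"
    by (rule finite_subset) (rule finite_submultisets)
  then show ?thesis
  proof (rule finite_image_factor)
    fix x y assume xy: "x \<in> {d \<in> carrier G. d divides a}" "y \<in> {d \<in> carrier G. d divides a}"
      and eq: "fmset G (w x) = fmset G (w y)"
    then have "x \<sim> y" using w fmset_ee ee_wfactorsD by (metis (no_types, lifting) mem_Collect_eq)
    then show "{z \<in> carrier G. z \<sim> x} = {z \<in> carrier G. z \<sim> y}"
      using xy by (auto intro: associated_trans associated_sym)
  qed
qed

text \<open>Divisors of a nonzero element are nonzero, so the count can be made in the monoid
  \<open>mult_of R\<close>, where nonzero elements are associates exactly when they are so in
  \<open>R\<close>.\<close>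

lemma (in factorial_domain) finite_divisor_classes:
  assumes a: "a \<in> carrier R - {\<zero>}"
  shows "finite ((\<lambda>d. {x \<in> carrier R. x \<sim> d}) ` {d \<in> carrier R. d divides a})"
proof -
  let ?D = "{d \<in> carrier R. d divides a}"
  have D: "?D \<subseteq> {d \<in> carrier (mult_of R). d divides\<^bsub>mult_of R\<^esub> a}"
    using a zero_divides by auto
  have "finite ((\<lambda>d. {x \<in> carrier (mult_of R). x \<sim>\<^bsub>mult_of R\<^esub> d}) ` ?D)"
    by (rule finite_subset[OF image_mono[OF D]])
      (use a factorial_monoid.finite_divisor_classes[OF factorial_monoid_axioms, of a] in auto)
  then show ?thesis
  proof (rule finite_image_factor)
    fix x y assume x: "x \<in> ?D" and y: "y \<in> ?D"
      and eq: "{z \<in> carrier (mult_of R). z \<sim>\<^bsub>mult_of R\<^esub> x} = {z \<in> carrier (mult_of R). z \<sim>\<^bsub>mult_of R\<^esub> y}"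
    have "x \<in> {z \<in> carrier (mult_of R). z \<sim>\<^bsub>mult_of R\<^esub> x}" using x D by auto
    then have "x \<sim> y" using x y eq assoc_iff_assoc_mult by auto
    then show "{z \<in> carrier R. z \<sim> x} = {z \<in> carrier R. z \<sim> y}"
      using x y by (auto intro: associated_trans associated_sym)
  qed
qed

section \<open>Unit groups of subfields and division of polynomials\<close>

lemma (in field) subfield_subgroup_units:
  assumes "subfield K R"
  shows "subgroup (K - {\<zero>}) (units_of R)"
proof -
  \<comment> \<open>\<open>Ring_Divisibility\<close> defines a second constant \<open>mult_of\<close>, which shadows this one.\<close>
  have "Multiplicative_Group.mult_of R = units_of R"
    by (simp add: Multiplicative_Group.mult_of_def units_of_def field_Units)
  then show ?thesis using subgroup_mult_of[OF assms] by simp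
qed

locale UP_field = UP + R?: field R

sublocale UP_field \<subseteq> UP_domain
  by unfold_locales

context UP_field
begin

text \<open>\<open>long_div_theorem\<close> is pseudo-division: it first scales \<open>f\<close> by
  a power of the leading coefficient of \<open>g\<close>. Over a field this power is a unit, and
  scaling by its inverse does not raise the degree of the remainder.\<close>

lemma long_division:
  assumes f: "f \<in> carrier P" and g: "g \<in> carrier P" "g \<noteq> \<zero>\<^bsub>P\<^esub>"
  shows "\<exists>q r. q \<in> carrier P \<and> r \<in> carrier P \<and> f = g \<otimes>\<^bsub>P\<^esub> q \<oplus>\<^bsub>P\<^esub> r \<and>
    (r = \<zero>\<^bsub>P\<^esub> \<or> deg R r < deg R g)"
proof -
  obtain q r and k :: nat where qr: "q \<in> carrier P" "r \<in> carrier P"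
      "lcoeff g [^] k \<odot>\<^bsub>P\<^esub> f = g \<otimes>\<^bsub>P\<^esub> q \<oplus>\<^bsub>P\<^esub> r" "r = \<zero>\<^bsub>P\<^esub> \<or> deg R r < deg R g"
    using long_div_theorem[OF g(1) f g(2)] by blast
  let ?l = "lcoeff g [^] k"
  have l: "?l \<in> Units R"
    using lcoeff_nonzero[OF g(2,1)] g(1) R.Units_pow_closed[of "lcoeff g" k] by (simp add: R.field_Units)
  then have c: "inv ?l \<in> carrier R" "?l \<in> carrier R" "inv ?l \<otimes> ?l = \<one>" by auto
  have "f = inv ?l \<odot>\<^bsub>P\<^esub> (?l \<odot>\<^bsub>P\<^esub> f)"
    using c f UP_smult_assoc1[of "inv ?l" ?l f] by simp
  also have "\<dots> = g \<otimes>\<^bsub>P\<^esub> (inv ?l \<odot>\<^bsub>P\<^esub> q) \<oplus>\<^bsub>P\<^esub> inv ?l \<odot>\<^bsub>P\<^esub> r"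
    using c(1) g qr by (simp add: UP_smult_r_distr UP_m_comm[of g] UP_smult_assoc2)
  finally have "f = g \<otimes>\<^bsub>P\<^esub> (inv ?l \<odot>\<^bsub>P\<^esub> q) \<oplus>\<^bsub>P\<^esub> inv ?l \<odot>\<^bsub>P\<^esub> r" .
  moreover have "inv ?l \<odot>\<^bsub>P\<^esub> r = \<zero>\<^bsub>P\<^esub> \<or> deg R (inv ?l \<odot>\<^bsub>P\<^esub> r) < deg R g"
    using qr c(1) deg_smult_decr[OF c(1) qr(2)] by auto
  ultimately show ?thesis
    using qr c(1) by (intro exI[of _ "inv ?l \<odot>\<^bsub>P\<^esub> q"] exI[of _ "inv ?l \<odot>\<^bsub>P\<^esub> r"]) simp
qed

text \<open>Euclidean domains are factorial, so the finiteness of divisor classes becomes available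
  in \<open>P\<close>.\<close>

lemma euclidean_domain_UP: "euclidean_domain P (deg R)"
  by (rule euclidean_domainI) (use long_division in blast)

section \<open>The rings \<open>const_term_ring R F\<close>: units, associates and irreducible
  monomials\<close>

lemma coeff_0_mult:
  "\<lbrakk>p \<in> carrier P; q \<in> carrier P\<rbrakk> \<Longrightarrow> coeff P (p \<otimes>\<^bsub>P\<^esub> q) 0 = coeff P p 0 \<otimes> coeff P q 0"
  by simp

lemma const_term_ring_eq:
  "const_term_ring R F = P\<lparr>carrier := {p \<in> carrier P. coeff P p 0 \<in> F}\<rparr>"
  by (simp add: const_term_ring_def P_def)

lemma const_term_ring_simps [simp]:
  "carrier (const_term_ring R F) = {p \<in> carrier P. coeff P p 0 \<in> F}"
  "mult (const_term_ring R F) = mult P"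
  "\<one>\<^bsub>const_term_ring R F\<^esub> = \<one>\<^bsub>P\<^esub>"
  "\<zero>\<^bsub>const_term_ring R F\<^esub> = \<zero>\<^bsub>P\<^esub>"
  by (simp_all add: const_term_ring_eq)

text \<open>This extreme case lets the description of associates in \<open>const_term_ring\<close>
  be applied to \<open>P\<close> itself.\<close>

lemma const_term_ring_carrier: "const_term_ring R (carrier R) = P"
proof -
  have "{p \<in> carrier P. coeff P p 0 \<in> carrier R} = carrier P" by auto
  then show ?thesis by (simp add: const_term_ring_eq)
qed

lemma domain_const_term_ring:
  assumes "subring F R"
  shows "domain (const_term_ring R F)"
  unfolding const_term_ring_eq
  by (intro subring_is_domain P.subringI)
    (auto simp: subringE[OF assms] simp del: coeff_mult simp: coeff_0_mult)

text \<open>Degrees add, so two factors of the unit polynomial are both constant. Conversely, the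
  inverse of a nonzero constant from \<open>F\<close> stays in \<open>F\<close> because
  \<open>F\<close> is a subfield.\<close>

lemma Units_const_term_ring:
  assumes F: "subfield F R"
  shows "Units (const_term_ring R F) = (\<lambda>a. monom P a 0) ` (F - {\<zero>})"
proof -
  note FR = subfieldE[OF F]
  show ?thesis
  proof (intro equalityI subsetI)
    fix u assume "u \<in> Units (const_term_ring R F)"
    then obtain v where uv: "u \<in> carrier P" "v \<in> carrier P" "coeff P u 0 \<in> F"
        "u \<otimes>\<^bsub>P\<^esub> v = \<one>\<^bsub>P\<^esub>"
      by (auto simp: Units_def)
    then have nz: "u \<noteq> \<zero>\<^bsub>P\<^esub>" "v \<noteq> \<zero>\<^bsub>P\<^esub>" using UP_one_not_zero by auto
    then have "deg R u + deg R v = 0" using uv deg_mult deg_one by metis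
    then have "u = monom P (coeff P u 0) 0" using uv deg_zero_impl_monom by simp
    moreover from this have "coeff P u 0 \<noteq> \<zero>" using nz by force
    ultimately show "u \<in> (\<lambda>a. monom P a 0) ` (F - {\<zero>})" using uv by blast
  next
    fix u assume "u \<in> (\<lambda>a. monom P a 0) ` (F - {\<zero>})"
    then obtain a where a: "a \<in> F" "a \<noteq> \<zero>" "u = monom P a 0" by auto
    have i: "inv a \<in> F" "a \<otimes> inv a = \<one>" "inv a \<otimes> a = \<one>"
      using R.subfield_m_inv[OF F, of a] a by auto
    have c: "a \<in> carrier R" "inv a \<in> carrier R" using a i FR(3) by auto
    have "monom P a 0 \<otimes>\<^bsub>P\<^esub> monom P (inv a) 0 = \<one>\<^bsub>P\<^esub>" "monom P (inv a) 0 \<otimes>\<^bsub>P\<^esub> monom P a 0 = \<one>\<^bsub>P\<^esub>"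
      using monom_mult[of a "inv a" 0 0] monom_mult[of "inv a" a 0 0] c i by auto
    then show "u \<in> Units (const_term_ring R F)"
      using a i c unfolding Units_def
      by (auto intro!: exI[of _ "monom P (inv a) 0"])
  qed
qed

lemma associated_const_term_ring:
  assumes F: "subfield F R"
    and "p \<in> carrier (const_term_ring R F)" "q \<in> carrier (const_term_ring R F)"
  shows "p \<sim>\<^bsub>const_term_ring R F\<^esub> q \<longleftrightarrow> (\<exists>a \<in> F - {\<zero>}. p = a \<odot>\<^bsub>P\<^esub> q)"
proof -
  interpret S: domain "const_term_ring R F"
    using domain_const_term_ring subfieldE(1)[OF F] by blast
  show ?thesis
    using assms subfieldE(3)[OF F]
    by (auto simp: S.ring_associated_iff Units_const_term_ring monom_mult_is_smult subset_eq)
qed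

lemma coset_eq_iff:
  assumes F: "subfield F R" and "a \<in> carrier R - {\<zero>}" "b \<in> carrier R - {\<zero>}"
  shows "(F - {\<zero>}) #>\<^bsub>units_of R\<^esub> a = (F - {\<zero>}) #>\<^bsub>units_of R\<^esub> b \<longleftrightarrow> (\<exists>c \<in> F - {\<zero>}. a = c \<otimes> b)"
  using group.rcos_eq_iff[OF R.units_group subfield_subgroup_units[OF F], of a b] assms
  by (simp add: R.field_Units units_of_carrier units_of_mult)

text \<open>In a factorization of a polynomial of degree 1 one factor is a nonzero constant. As a
  member of the ring it has its constant term in \<open>F\<close>, so it is a unit. The coefficient
  \<open>a\<close> itself may lie outside \<open>F\<close>.\<close>

lemma ring_irreducible_monom_1:
  assumes F: "subfield F R" and a: "a \<in> carrier R - {\<zero>}"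
  shows "ring_irreducible\<^bsub>const_term_ring R F\<^esub> (monom P a 1)"
proof -
  interpret S: domain "const_term_ring R F"
    using domain_const_term_ring subfieldE(1)[OF F] by blast
  have const_unit: "p \<in> Units (const_term_ring R F)"
    if p: "p \<in> carrier P" "coeff P p 0 \<in> F" "p \<noteq> \<zero>\<^bsub>P\<^esub>" "deg R p = 0" for p
  proof -
    have "p = monom P (coeff P p 0) 0" using p deg_zero_impl_monom by blast
    moreover have "coeff P p 0 \<noteq> \<zero>" using lcoeff_nonzero[OF p(3,1)] p(4) by simp
    ultimately show ?thesis using p(2) by (auto simp: Units_const_term_ring[OF F])
  qed
  \<comment> \<open>The zero polynomial has degree 0 by convention, so degree 1 rules it
    out.\<close>
  have nz: "monom P a 1 \<noteq> \<zero>\<^bsub>P\<^esub>"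
    using a deg_monom[of a 1] by (metis DiffE deg_zero singletonI zero_neq_one)
  show ?thesis
  proof (rule S.ring_irreducibleI)
    show "monom P a 1 \<in> carrier (const_term_ring R F) - {\<zero>\<^bsub>const_term_ring R F\<^esub>}"
      using a nz subringE(2)[OF subfieldE(1)[OF F]] by simp
    show "monom P a 1 \<notin> Units (const_term_ring R F)"
    proof
      assume "monom P a 1 \<in> Units (const_term_ring R F)"
      then obtain b where "b \<in> F" "monom P a 1 = monom P b 0"
        by (auto simp: Units_const_term_ring[OF F])
      then show False
        using a subfieldE(3)[OF F] deg_monom[of a 1] deg_const[of b] by auto
    qed
    fix p q
    assume pq: "p \<in> carrier (const_term_ring R F)" "q \<in> carrier (const_term_ring R F)"
      and eq: "monom P a 1 = p \<otimes>\<^bsub>const_term_ring R F\<^esub> q"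
    then have nz': "p \<noteq> \<zero>\<^bsub>P\<^esub>" "q \<noteq> \<zero>\<^bsub>P\<^esub>" using nz by auto
    then have "deg R p + deg R q = 1"
      using pq eq a deg_mult[of p q] deg_monom[of a 1] by simp
    then have "deg R p = 0 \<or> deg R q = 0" by arith
    then show "p \<in> Units (const_term_ring R F) \<or> q \<in> Units (const_term_ring R F)"
      using const_unit pq nz' by auto
  qed
qed

section \<open>The idf property and the index of F^* in the unit group of the field\<close>

lemma idf_domain_const_term_ring_iff:
  assumes F: "subfield F R"
  shows "idf_domain (const_term_ring R F) \<longleftrightarrow> finite (rcosets\<^bsub>units_of R\<^esub> (F - {\<zero>}))"
proof -
  let ?S = "const_term_ring R F"
  let ?r = "{(x, y). x \<in> carrier ?S \<and> y \<in> carrier ?S \<and> x \<sim>\<^bsub>?S\<^esub> y}"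
  let ?coset = "\<lambda>a. (F - {\<zero>}) #>\<^bsub>units_of R\<^esub> a"
  interpret S: domain ?S
    using domain_const_term_ring subfieldE(1)[OF F] by blast
  have FR: "F \<subseteq> carrier R" "\<zero> \<in> F" using subfieldE(1,3)[OF F] subringE(2) by auto
  have quot: "A // ?r = (\<lambda>d. ?r `` {d}) ` A" for A
    by (auto simp: quotient_def)
  have cosets: "rcosets\<^bsub>units_of R\<^esub> (F - {\<zero>}) = ?coset ` (carrier R - {\<zero>})"
    by (auto simp: RCOSETS_def units_of_carrier R.field_Units)
  have class_eq: "?r `` {x} = ?r `` {y} \<longleftrightarrow> x \<sim>\<^bsub>?S\<^esub> y" if "x \<in> carrier ?S" "y \<in> carrier ?S" for x y
    using that by (auto intro: S.associated_trans S.associated_sym simp del: const_term_ring_simps)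
  show ?thesis
  proof
    assume idf: "idf_domain ?S"
    \<comment> \<open>The square of X is used rather than X: here the cofactor of aX is again a
      multiple of X and so lies in the ring, whereas the cofactor of aX in X is the constant
      \<open>inv a\<close>, which may lie outside \<open>F\<close>.\<close>
    have mX: "monom P a 1 \<in> irreducible_divisors ?S (monom P \<one> 2)" if "a \<in> carrier R - {\<zero>}" for a
    proof -
      have "inv a \<in> carrier R" "a \<otimes> inv a = \<one>" using that field_Units by auto
      then have "monom P \<one> 2 = monom P a 1 \<otimes>\<^bsub>P\<^esub> monom P (inv a) 1"
        using that monom_mult[of a "inv a" 1 1] by (simp add: numeral_2_eq_2)
      then have "monom P a 1 divides\<^bsub>?S\<^esub> monom P \<one> 2"
        using that \<open>inv a \<in> carrier R\<close> FR unfolding factor_def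
        by (intro bexI[of _ "monom P (inv a) 1"]) auto
      then show ?thesis
        using that FR ring_irreducible_monom_1[OF F that] by (auto simp: irreducible_divisors_def)
    qed
    have "monom P \<one> 2 \<noteq> \<zero>\<^bsub>P\<^esub>"
      using deg_monom[of \<one> 2] by (metis R.one_closed R.one_not_zero deg_zero zero_neq_numeral)
    then have "finite (irreducible_divisors ?S (monom P \<one> 2) // ?r)"
      using idf FR by (simp add: idf_domain_def)
    then have "finite ((\<lambda>d. ?r `` {d}) ` (\<lambda>a. monom P a 1) ` (carrier R - {\<zero>}))"
      unfolding quot by (rule finite_subset[rotated]) (use mX in blast)
    then have "finite ((\<lambda>a. ?r `` {monom P a 1}) ` (carrier R - {\<zero>}))"
      by (simp only: image_image)
    then show "finite (rcosets\<^bsub>units_of R\<^esub> (F - {\<zero>}))"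
      unfolding cosets
    proof (rule finite_image_factor)
      fix a b assume ab: "a \<in> carrier R - {\<zero>}" "b \<in> carrier R - {\<zero>}"
        and "?r `` {monom P a 1} = ?r `` {monom P b 1}"
      then have "monom P a 1 \<sim>\<^bsub>?S\<^esub> monom P b 1"
        using class_eq[of "monom P a 1" "monom P b 1"] FR by simp
      then obtain c where c: "c \<in> F - {\<zero>}" "monom P a 1 = c \<odot>\<^bsub>P\<^esub> monom P b 1"
        using associated_const_term_ring[OF F] ab FR by auto
      then have "monom P a 1 = monom P (c \<otimes> b) 1"
        using ab FR(1) monom_mult_smult[of c b 1] by auto
      moreover have "c \<otimes> b \<in> carrier R" using ab c(1) FR(1) by blast
      ultimately have "a = c \<otimes> b"
        using ab(1) inj_onD[OF monom_inj] by blast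
      then show "?coset a = ?coset b"
        using coset_eq_iff[OF F ab] c by blast
    qed
  next
    assume fin: "finite (rcosets\<^bsub>units_of R\<^esub> (F - {\<zero>}))"
    interpret E: euclidean_domain P "deg R" by (rule euclidean_domain_UP)
    show "idf_domain ?S"
      unfolding idf_domain_def
    proof (intro conjI ballI)
      fix f assume "f \<in> carrier ?S - {\<zero>\<^bsub>?S\<^esub>}"
      then have f: "f \<in> carrier P" "f \<noteq> \<zero>\<^bsub>P\<^esub>" by auto
      let ?D = "irreducible_divisors ?S f"
      let ?class = "\<lambda>d. {x \<in> carrier P. x \<sim>\<^bsub>P\<^esub> d}"
      have D: "d \<in> carrier P" "coeff P d 0 \<in> F" "d \<noteq> \<zero>\<^bsub>P\<^esub>" "d divides\<^bsub>P\<^esub> f" "lcoeff d \<in> carrier R - {\<zero>}"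
        if "d \<in> ?D" for d
      proof -
        show d: "d \<in> carrier P" "coeff P d 0 \<in> F" "d \<noteq> \<zero>\<^bsub>P\<^esub>" "d divides\<^bsub>P\<^esub> f"
          using that by (auto simp: irreducible_divisors_def ring_irreducible_def factor_def)
        show "lcoeff d \<in> carrier R - {\<zero>}" using d lcoeff_nonzero by simp
      qed
      have "finite (?class ` ?D)"
        by (rule finite_subset[OF image_mono E.finite_divisor_classes[of f]]) (use f D in auto)
      moreover have "finite ((\<lambda>d. ?coset (lcoeff d)) ` ?D)"
        by (rule finite_subset[OF _ fin]) (use D cosets in auto)
      \<comment> \<open>The two invariants together fix the class in \<open>?S\<close>: equality of
        the first leaves a nonzero scalar from \<open>R\<close>, and equality of the second forces
        this scalar into \<open>F\<close>.\<close>
      ultimately have "finite ((\<lambda>d. (?class d, ?coset (lcoeff d))) ` ?D)"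
        by (rule finite_subset[OF _ finite_cartesian_product, rotated]) auto
      then show "finite (?D // ?r)"
        unfolding quot
      proof (rule finite_image_factor)
        fix x y assume x: "x \<in> ?D" and y: "y \<in> ?D"
          and "(?class x, ?coset (lcoeff x)) = (?class y, ?coset (lcoeff y))"
        then have eq: "?class x = ?class y" "?coset (lcoeff x) = ?coset (lcoeff y)" by auto
        have "x \<in> ?class x" using D[OF x] by simp
        then have "x \<sim>\<^bsub>P\<^esub> y" using eq by auto
        then obtain a where a: "a \<in> carrier R - {\<zero>}" "x = a \<odot>\<^bsub>P\<^esub> y"
          using associated_const_term_ring[OF carrier_is_subfield] D(1)[OF x] D(1)[OF y]
          by (auto simp: const_term_ring_carrier)
        then have lc: "lcoeff x = a \<otimes> lcoeff y" using D(1)[OF y] by simp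
        \<comment> \<open>This is a second expression for \<open>lcoeff x\<close>, now with a factor
          from \<open>F\<close>. Cancelling the nonzero \<open>lcoeff y\<close> identifies the
          scalar \<open>a\<close> with \<open>c\<close>.\<close>
        obtain c where c: "c \<in> F - {\<zero>}" "lcoeff x = c \<otimes> lcoeff y"
          using eq(2) coset_eq_iff[OF F D(5)[OF x] D(5)[OF y]] by blast
        have "a = c"
          using lc c a FR(1) D(5)[OF y] R.m_rcancel[of "lcoeff y" a c] by auto
        then have "x \<sim>\<^bsub>?S\<^esub> y"
          using associated_const_term_ring[OF F] a c D[OF x] D[OF y] by auto
        then show "?r `` {x} = ?r `` {y}"
          using class_eq[of x y] D[OF x] D[OF y] by simp
      qed
    qed (rule S.domain_axioms)
  qed
qed

end

section \<open>Comparison of the indices of K^* and M^* in L^*\<close>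

theorem proposition2p6:
  fixes L :: "('a, 'm) ring_scheme" and K M :: "'a set"
    and T R :: "('a, nat \<Rightarrow> 'a) up_ring"
  assumes "field L"
    and "subfield K L"
    and "subfield M (L \<lparr> carrier := K \<rparr>)"
    and "T = const_term_ring L K"
    and "R = const_term_ring L M"
  shows "((\<exists>f \<in> X_ideal L. ring_irreducible\<^bsub>T\<^esub> f) \<longrightarrow>
           (idf_domain R \<longleftrightarrow>
             idf_domain T \<and>
             finite (carrier (units_of (L \<lparr> carrier := K \<rparr>) Mod Units (L \<lparr> carrier := M \<rparr>)))))
       \<and> ((\<not> (\<exists>f \<in> X_ideal L. ring_irreducible\<^bsub>T\<^esub> f)) \<longrightarrow>
           (idf_domain R \<longleftrightarrow> idf_domain T))"
proof -
  interpret UP_field L "UP L" by (simp add: UP_field_def assms(1))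
  note K = assms(2)
  interpret LK: field "L\<lparr>carrier := K\<rparr>" using R.subfield_iff(2)[OF K] .
  have MK: "M \<subseteq> K" using subfieldE(3)[OF assms(3)] by simp
  have KL: "K \<subseteq> carrier L" using subfieldE(3)[OF K] .
  have M: "subfield M L"
    using LK.subfield_iff(2)[OF assms(3)] MK KL by (intro R.subfield_iff(1)) auto
  have units: "Units (L\<lparr>carrier := K\<rparr>) = K - {\<zero>\<^bsub>L\<^esub>}" "Units (L\<lparr>carrier := M\<rparr>) = M - {\<zero>\<^bsub>L\<^esub>}"
    using subfield.subfield_Units[OF K] subfield.subfield_Units[OF M] by auto
  \<comment> \<open>Presenting K^* as a subgroup of \<open>units_of L\<close> gives the cosets that
    make up K^*/M^* the form required by \<open>finite_rcosets_tower\<close>.\<close>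
  have unitsK: "units_of (L\<lparr>carrier := K\<rparr>) = (units_of L)\<lparr>carrier := K - {\<zero>\<^bsub>L\<^esub>}\<rparr>"
    by (simp add: units_of_def units)
  have X: "monom (UP L) \<one>\<^bsub>L\<^esub> 1 \<in> X_ideal L"
    unfolding X_ideal_def by (rule P.cgenideal_self) simp
  have "ring_irreducible\<^bsub>T\<^esub> (monom (UP L) \<one>\<^bsub>L\<^esub> 1)"
    using ring_irreducible_monom_1[OF K, of "\<one>\<^bsub>L\<^esub>"] assms(4) by simp
  moreover have "idf_domain R \<longleftrightarrow> idf_domain T \<and>
      finite (carrier (units_of (L \<lparr> carrier := K \<rparr>) Mod Units (L \<lparr> carrier := M \<rparr>)))"
    unfolding assms(4,5) idf_domain_const_term_ring_iff[OF K] idf_domain_const_term_ring_iff[OF M]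
      units unitsK FactGroup_def partial_object.simps
    by (rule group.finite_rcosets_tower[OF R.units_group])
      (use subfield_subgroup_units[OF K] subfield_subgroup_units[OF M] MK in auto)
  ultimately show ?thesis using X by blast
qed

end
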